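(* Let $A=\{a_1,a_2\}$ and $E=\{e_1,e_2\}$ be two alphabets. Then, as formal power series in $z$, $$\sum_{n=0}^{\infty} S_n(A)\,S_{2n+3}(E)\,z^n=\frac{(e_1+e_2)\left((e_1+e_2)^2-2e_1e_2\right)-e_1^2e_2^2(a_1+a_2)(e_1+e_2)z}{\left(\sum_{n=0}^{\infty}S_n(-A)e_1^{2n}z^n\right)\left(\sum_{n=0}^{\infty}S_n(-A)e_2^{2n}z^n\right)}.$$
   Context: Here $a_1,a_2,e_1,e_2$ are commuting variables (an alphabet is a set of variables), and identities are between formal power series in $z$ with coefficients in $\mathbb{Z}[a_1,a_2,e_1,e_2]$; the denominator has constant term $1$, so it is invertible. For an alphabet $X=\{x_1,x_2\}$, $S_n(X)$ is defined by $\sum_{n\ge 0}S_n(X)z^n=\frac{1}{(1-x_1z)(1-x_2z)}$, equivalently $S_n(X)=\frac{x_1^{n+1}-x_2^{n+1}}{x_1-x_2}$ for $n\ge 0$, and $S_n(X)=0$ for $n<0$. The quantities $S_n(-A)$ are defined by $\sum_{n\ge 0}S_n(-A)z^n=(1-a_1z)(1-a_2z)$. *)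

theory Defs
  imports "HOL-Library.Poly_Mapping" "HOL-Computational_Algebra.Formal_Power_Series"
begin

text \<open>The coefficient ring: polynomials with integer coefficients in exactly four
  commuting indeterminates.  An element is a finitely supported map from monomials to integers,
  and a monomial is a map from letters to exponents.\<close>

datatype letter = A1 | A2 | E1 | E2

type_synonym coeff_ring = "(letter \<Rightarrow>\<^sub>0 nat) \<Rightarrow>\<^sub>0 int"

definition var :: "letter \<Rightarrow> coeff_ring" where
  "var x = Poly_Mapping.single (Poly_Mapping.single x 1) 1"

abbreviation a\<^sub>1 :: coeff_ring where "a\<^sub>1 \<equiv> var A1"
abbreviation a\<^sub>2 :: coeff_ring where "a\<^sub>2 \<equiv> var A2"
abbreviation e\<^sub>1 :: coeff_ring where "e\<^sub>1 \<equiv> var E1"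
abbreviation e\<^sub>2 :: coeff_ring where "e\<^sub>2 \<equiv> var E2"

lemma var_eq_iff [simp]: "var x = var y \<longleftrightarrow> x = y"
proof
  assume "var x = var y"
  then have "Poly_Mapping.keys (var x) = Poly_Mapping.keys (var y)" by simp
  then have "Poly_Mapping.single x (1::nat) = Poly_Mapping.single y 1"
    by (simp add: var_def)
  then have "Poly_Mapping.keys (Poly_Mapping.single x (1::nat))
      = Poly_Mapping.keys (Poly_Mapping.single y (1::nat))" by simp
  then show "x = y" by simp
qed simp

text \<open>Division of power series over a commutative ring in which only the constant term \<open>1\<close> of
  the denominator is known to be invertible.  The library operation \<open>/\<close> on \<open>fps\<close> needs an
  inverse operation on the coefficients, which the polynomial ring lacks.  The second argument
  of \<open>fps_right_inverse\<close> is the inverse of the constant term, so \<open>fps_quot\<close> is meaningful only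
  if \<open>fps_nth g 0 = 1\<close>.\<close>

definition fps_quot :: "'a::comm_ring_1 fps \<Rightarrow> 'a fps \<Rightarrow> 'a fps" where
  "fps_quot f g = f * fps_right_inverse g 1"

lemma fps_quot_eq_iff:
  assumes "fps_nth g 0 = 1"
  shows "fps_quot f g = h \<longleftrightarrow> f = h * g"
proof -
  have inv: "g * fps_right_inverse g 1 = 1"
    using assms by (intro fps_right_inverse) simp
  then have inv': "fps_right_inverse g 1 * g = 1"
    by (simp add: mult.commute)
  show ?thesis
    unfolding fps_quot_def by (metis inv inv' mult.assoc mult.right_neutral)
qed

text \<open>An alphabet is a finite set of pairwise distinct elements of the coefficient ring.\<close>

definition alphabet_prod :: "'a::comm_ring_1 set \<Rightarrow> 'a fps" where
  "alphabet_prod X = (\<Prod>x\<in>X. 1 - fps_const x * fps_X)"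

definition S :: "int \<Rightarrow> 'a::comm_ring_1 set \<Rightarrow> 'a" where
  "S n X = (if n < 0 then 0 else fps_nth (fps_quot 1 (alphabet_prod X)) (nat n))"

text \<open>\<open>S_neg n X\<close> stands for \<open>S\<^sub>n(-X)\<close>, where \<open>-X\<close> is the formal negative of the alphabet
  and not the set of the negated letters.\<close>

definition S_neg :: "int \<Rightarrow> 'a::comm_ring_1 set \<Rightarrow> 'a" where
  "S_neg n X = (if n < 0 then 0 else fps_nth (alphabet_prod X) (nat n))"

end

theory Submission
  imports Defs
begin

text \<open>Both \<open>S\<^sub>n(A)\<close> and \<open>S\<^sub>2\<^sub>n\<^sub>+\<^sub>3(E)\<close> satisfy second order linear recurrences in \<open>n\<close>, with
  characteristic roots \<open>a\<^sub>1, a\<^sub>2\<close> and \<open>e\<^sub>1\<^sup>2, e\<^sub>2\<^sup>2\<close> respectively.  Their product therefore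
  satisfies the fourth order recurrence whose characteristic roots are the four products of these
  roots, and the denominator of the theorem is the reversed characteristic polynomial.  The
  numerator is found by comparing the first four coefficients.  This argument needs no division
  by \<open>e\<^sub>1 - e\<^sub>2\<close> and hence works over every commutative ring.\<close>

lemma fps_nth_mult_const_X_power:
  fixes f :: "'a::comm_ring_1 fps"
  shows "fps_nth (f * (fps_const c * fps_X ^ k)) n = (if n < k then 0 else c * fps_nth f (n - k))"
  by (simp add: mult.left_commute[of f] fps_X_power_mult_right_nth)

text \<open>Distinctness matters because \<open>{x, y}\<close> is a set: for equal letters it
  collapses to a singleton and one factor is lost.\<close>

lemma alphabet_prod_pair:
  fixes x y :: "'a::comm_ring_1"
  assumes "x \<noteq> y"
  shows "alphabet_prod {x, y} =
    1 - fps_const (x + y) * fps_X ^ 1 + fps_const (x * y) * fps_X ^ 2"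
proof -
  have "alphabet_prod {x, y} = (1 - fps_const x * fps_X) * (1 - fps_const y * fps_X)"
    using assms by (simp add: alphabet_prod_def)
  then show ?thesis
    by (simp add: algebra_simps power2_eq_square flip: fps_const_add fps_const_mult)
qed

lemma S_mult_alphabet_prod:
  fixes X :: "'a::comm_ring_1 set"
  shows "Abs_fps (\<lambda>n. S (int n) X) * alphabet_prod X = 1"
proof -
  have "fps_nth (alphabet_prod X) 0 = 1"
    \<comment> \<open>An infinite product over a set is 1 by default, so the constant term is 1 for
      every \<open>X\<close>.\<close>
    unfolding alphabet_prod_def by (induction X rule: infinite_finite_induct) simp_all
  moreover have "Abs_fps (\<lambda>n. S (int n) X) = fps_quot 1 (alphabet_prod X)"
    by (rule fps_ext) (simp add: S_def)
  ultimately show ?thesis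
    using fps_quot_eq_iff by metis
qed

lemma S_pair_recurrence:
  fixes x y :: "'a::comm_ring_1"
  assumes "x \<noteq> y"
  shows "S 0 {x, y} = 1" "S 1 {x, y} = x + y"
    "S (int n + 2) {x, y} = (x + y) * S (int n + 1) {x, y} - x * y * S (int n) {x, y}"
proof -
  let ?F = "Abs_fps (\<lambda>n. S (int n) {x, y})"
  have "fps_nth (?F * alphabet_prod {x, y}) m =
      S (int m) {x, y} - (if m < 1 then 0 else (x + y) * S (int (m - 1)) {x, y})
        + (if m < 2 then 0 else x * y * S (int (m - 2)) {x, y})" for m
    unfolding alphabet_prod_pair[OF assms] ring_distribs fps_add_nth fps_sub_nth
      fps_nth_mult_const_X_power
    by simp
  then have coeff: "S (int m) {x, y} - (if m < 1 then 0 else (x + y) * S (int (m - 1)) {x, y})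
        + (if m < 2 then 0 else x * y * S (int (m - 2)) {x, y}) = (if m = 0 then 1 else 0)" for m
    unfolding S_mult_alphabet_prod by simp
  show S0: "S 0 {x, y} = 1"
    using coeff[of 0] by simp
  show "S 1 {x, y} = x + y"
    using coeff[of 1] S0 by simp
  show "S (int n + 2) {x, y} = (x + y) * S (int n + 1) {x, y} - x * y * S (int n) {x, y}"
    using coeff[of "n + 2"] by (simp add: algebra_simps)
qed

lemma S_pair_odd_recurrence:
  fixes x y :: "'a::comm_ring_1"
  assumes "x \<noteq> y"
  shows "S 3 {x, y} = (x + y) * (x^2 + y^2)"
    "S 5 {x, y} = (x + y) * (x^4 + x^2 * y^2 + y^4)"
    "S (2 * int n + 7) {x, y} =
      (x^2 + y^2) * S (2 * int n + 5) {x, y} - x^2 * y^2 * S (2 * int n + 3) {x, y}"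
proof -
  note r = S_pair_recurrence(3)[OF assms]
  have S2: "S 2 {x, y} = (x + y) * (x + y) - x * y"
    using r[of 0] S_pair_recurrence(1,2)[OF assms] by simp
  have S3: "S 3 {x, y} = (x + y) * S 2 {x, y} - x * y * (x + y)"
    using r[of 1] S_pair_recurrence(1,2)[OF assms] by simp
  have S4: "S 4 {x, y} = (x + y) * S 3 {x, y} - x * y * S 2 {x, y}"
    using r[of 2] by simp
  have S5: "S 5 {x, y} = (x + y) * S 4 {x, y} - x * y * S 3 {x, y}"
    using r[of 3] by simp
  show "S 3 {x, y} = (x + y) * (x^2 + y^2)"
    unfolding S3 S2 by (simp add: algebra_simps power2_eq_square power4_eq_xxxx)
  show "S 5 {x, y} = (x + y) * (x^4 + x^2 * y^2 + y^4)"
    unfolding S5 S4 S3 S2 by (simp add: algebra_simps power2_eq_square power4_eq_xxxx)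
  \<comment> \<open>Three consecutive instances of the recurrence reduce both sides of the odd-index
    claim to the terms of index 2n+4 and 2n+3.\<close>
  have S5': "S (2 * int n + 5) {x, y} =
      (x + y) * S (2 * int n + 4) {x, y} - x * y * S (2 * int n + 3) {x, y}"
    using r[of "2 * n + 3"] by (simp add: algebra_simps)
  have S6': "S (2 * int n + 6) {x, y} =
      (x + y) * S (2 * int n + 5) {x, y} - x * y * S (2 * int n + 4) {x, y}"
    using r[of "2 * n + 4"] by (simp add: algebra_simps)
  have S7': "S (2 * int n + 7) {x, y} =
      (x + y) * S (2 * int n + 6) {x, y} - x * y * S (2 * int n + 5) {x, y}"
    using r[of "2 * n + 5"] by (simp add: algebra_simps)
  show "S (2 * int n + 7) {x, y} =
      (x^2 + y^2) * S (2 * int n + 5) {x, y} - x^2 * y^2 * S (2 * int n + 3) {x, y}"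
    unfolding S7' S6' S5' by (simp add: algebra_simps power2_eq_square power4_eq_xxxx)
qed

text \<open>This is the substitution of c^2 z for z in the quadratic polynomial
  \<open>alphabet_prod {x, y}\<close>.\<close>

lemma S_neg_pair_fps:
  fixes x y c :: "'a::comm_ring_1"
  assumes "x \<noteq> y"
  shows "Abs_fps (\<lambda>n. S_neg (int n) {x, y} * c ^ (2 * n)) =
    1 - fps_const ((x + y) * c^2) * fps_X ^ 1 + fps_const (x * y * c^4) * fps_X ^ 2"
  by (rule fps_ext)
    (auto simp: S_neg_def alphabet_prod_pair[OF assms] le_Suc_eq)

text \<open>If p = a + b and q = ab, the coefficients are, up to sign, the elementary symmetric
  functions of au, bu, av, bv.\<close>

lemma fps_quadratic_mult:
  fixes p q u v :: "'a::comm_ring_1"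
  shows "(1 - fps_const (p * u) * fps_X ^ 1 + fps_const (q * u^2) * fps_X ^ 2) *
      (1 - fps_const (p * v) * fps_X ^ 1 + fps_const (q * v^2) * fps_X ^ 2) =
    1 - fps_const (p * (u + v)) * fps_X ^ 1
      + fps_const (q * (u^2 + v^2) + p^2 * u * v) * fps_X ^ 2
      - fps_const (p * q * u * v * (u + v)) * fps_X ^ 3
      + fps_const (q^2 * u^2 * v^2) * fps_X ^ 4"
  by (simp add: algebra_simps power2_eq_square power3_eq_cube power4_eq_xxxx
    flip: fps_const_add fps_const_mult)

text \<open>Both sequences reduce to their values at n and n + 1, which leaves a polynomial
  identity; no roots of the recurrence of \<open>T\<close> are needed.\<close>

lemma product_recurrence:
  fixes T U :: "nat \<Rightarrow> 'a::comm_ring_1"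
  assumes T: "\<And>n. T (n + 2) = p * T (n + 1) - q * T n"
    and U: "\<And>n. U (n + 2) = (u + v) * U (n + 1) - u * v * U n"
  shows "T (n + 4) * U (n + 4) - p * (u + v) * (T (n + 3) * U (n + 3))
    + (q * (u^2 + v^2) + p^2 * u * v) * (T (n + 2) * U (n + 2))
    - p * q * u * v * (u + v) * (T (n + 1) * U (n + 1))
    + q^2 * u^2 * v^2 * (T n * U n) = 0"
proof -
  have *: "T (n + 3) = p * T (n + 2) - q * T (n + 1)" "T (n + 4) = p * T (n + 3) - q * T (n + 2)"
    "U (n + 3) = (u + v) * U (n + 2) - u * v * U (n + 1)"
    "U (n + 4) = (u + v) * U (n + 3) - u * v * U (n + 2)"
    using T[of "n + 1"] T[of "n + 2"] U[of "n + 1"] U[of "n + 2"]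
    by (simp_all add: eval_nat_numeral)
  show ?thesis
    unfolding * T[of n] U[of n] by (simp add: algebra_simps power2_eq_square power4_eq_xxxx)
qed

lemma product_fps:
  fixes T U :: "nat \<Rightarrow> 'a::comm_ring_1"
  assumes T: "\<And>n. T (n + 2) = p * T (n + 1) - q * T n" and T0: "T 0 = 1" and T1: "T 1 = p"
    and U: "\<And>n. U (n + 2) = (u + v) * U (n + 1) - u * v * U n"
  shows "Abs_fps (\<lambda>n. T n * U n) *
    ((1 - fps_const (p * u) * fps_X ^ 1 + fps_const (q * u^2) * fps_X ^ 2) *
     (1 - fps_const (p * v) * fps_X ^ 1 + fps_const (q * v^2) * fps_X ^ 2)) =
    fps_const (U 0) + fps_const (p * (U 1 - (u + v) * U 0)) * fps_X ^ 1
      + fps_const (q * ((u^2 + u * v + v^2) * U 0 - (u + v) * U 1)) * fps_X ^ 2" (is "?F * (?D1 * ?D2) = ?R")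
proof (rule fps_ext)
  fix n
  have T2: "T 2 = p * p - q" and T3: "T 3 = p * T 2 - q * p"
    and U2: "U 2 = (u + v) * U 1 - u * v * U 0" and U3: "U 3 = (u + v) * U 2 - u * v * U 1"
    using T[of 0] T[of 1] U[of 0] U[of 1] T0 T1 by (simp_all add: eval_nat_numeral)
  have coeff: "fps_nth (?F * (?D1 * ?D2)) n =
    T n * U n - (if n < 1 then 0 else p * (u + v) * (T (n - 1) * U (n - 1)))
    + (if n < 2 then 0 else (q * (u^2 + v^2) + p^2 * u * v) * (T (n - 2) * U (n - 2)))
    - (if n < 3 then 0 else p * q * u * v * (u + v) * (T (n - 3) * U (n - 3)))
    + (if n < 4 then 0 else q^2 * u^2 * v^2 * (T (n - 4) * U (n - 4)))"
    unfolding fps_quadratic_mult ring_distribs(1)[of ?F] right_diff_distrib[of ?F]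
      fps_add_nth fps_sub_nth fps_nth_mult_const_X_power
    by simp
  consider "n = 0" | "n = 1" | "n = 2" | "n = 3" | "n \<ge> 4"
    by linarith
  then show "fps_nth (?F * (?D1 * ?D2)) n = fps_nth ?R n"
  proof cases
    case 1
    then show ?thesis unfolding coeff by (simp add: T0)
  next
    case 2
    then show ?thesis unfolding coeff by (simp add: T0 T1[simplified] algebra_simps)
  next
    case 3
    have "(p * p - q) * ((u + v) * U 1 - u * v * U 0) - p * (u + v) * (p * U 1)
        + (q * (u^2 + v^2) + p^2 * u * v) * U 0
      = q * ((u^2 + u * v + v^2) * U 0 - (u + v) * U 1)"
      by (simp add: algebra_simps power2_eq_square power4_eq_xxxx)
    with 3 show ?thesis unfolding coeff by (simp add: T0 T1[simplified] T2 U2)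
  next
    case 4
    \<comment> \<open>\<open>T 0 = 1\<close> and \<open>T 1 = p\<close> amount to extending
      \<open>T\<close> by the value 0 at -1. This is the product recurrence started at -1, so its
      last term drops out and the numerator has no cubic term.\<close>
    have "T 3 * U 3 - p * (u + v) * (T 2 * U 2)
        + (q * (u^2 + v^2) + p^2 * u * v) * (p * U 1) - p * q * u * v * (u + v) * U 0 = 0"
      unfolding T3 U3 T2 U2 by (simp add: algebra_simps power2_eq_square power4_eq_xxxx)
    with 4 show ?thesis unfolding coeff by (simp add: T0 T1[simplified])
  next
    case 5
    then obtain m where "n = m + 4"
      using le_Suc_ex add.commute by metis
    then show ?thesis
      unfolding coeff using product_recurrence[of T p q U u v m, OF T U]
      by (simp add: add.commute[of 3])
  qed
qed

lemma S_pair_product_fps: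
  fixes a b c d :: "'a::comm_ring_1"
  assumes ab: "a \<noteq> b" and cd: "c \<noteq> d"
  shows "Abs_fps (\<lambda>n. S (int n) {a, b} * S (2 * int n + 3) {c, d}) *
      (Abs_fps (\<lambda>n. S_neg (int n) {a, b} * c ^ (2 * n)) *
       Abs_fps (\<lambda>n. S_neg (int n) {a, b} * d ^ (2 * n))) =
    fps_const ((c + d) * ((c + d)^2 - 2 * c * d))
      - fps_const (c^2 * d^2 * (a + b) * (c + d)) * fps_X"
proof -
  let ?T = "\<lambda>n. S (int n) {a, b}" and ?U = "\<lambda>n. S (2 * int n + 3) {c, d}"
  note E = S_pair_odd_recurrence[OF cd]
  have T: "?T (n + 2) = (a + b) * ?T (n + 1) - a * b * ?T n" for n
    using S_pair_recurrence(3)[OF ab, of n] by (simp add: algebra_simps)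
  have U: "?U (n + 2) = (c^2 + d^2) * ?U (n + 1) - c^2 * d^2 * ?U n" for n
    using E(3)[of n] by (simp add: algebra_simps)
  have D: "Abs_fps (\<lambda>n. S_neg (int n) {a, b} * x ^ (2 * n)) =
      1 - fps_const ((a + b) * x^2) * fps_X ^ 1 + fps_const (a * b * (x^2)^2) * fps_X ^ 2" for x
    using S_neg_pair_fps[OF ab, of x] by simp
  have U0: "?U 0 = (c + d) * (c^2 + d^2)" and U1: "?U 1 = (c + d) * (c^4 + c^2 * d^2 + d^4)"
    using E(1,2) by simp_all
  have R0: "?U 0 = (c + d) * ((c + d)^2 - 2 * c * d)"
    unfolding U0 by (simp add: algebra_simps power2_eq_square power4_eq_xxxx)
  \<comment> \<open>Running the recurrence of \<open>?U\<close> back one step gives the value c + d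
    at -1, which is the complete symmetric function of degree 1.\<close>
  have R1: "(a + b) * (?U 1 - (c^2 + d^2) * ?U 0) = - (c^2 * d^2 * (a + b) * (c + d))"
    unfolding U0 U1 by (simp add: algebra_simps power2_eq_square power4_eq_xxxx)
  \<comment> \<open>With the common factor c + d removed, \<open>?U 0\<close> is c^2 + d^2 and
    \<open>?U 1\<close> is c^4 + c^2 d^2 + d^4, so the two products cancel and the quadratic term
    vanishes.\<close>
  have R2: "a * b * (((c^2)^2 + c^2 * d^2 + (d^2)^2) * ?U 0 - (c^2 + d^2) * ?U 1) = 0"
    unfolding U0 U1 by (simp add: algebra_simps power2_eq_square power4_eq_xxxx)
  have "?T 0 = 1" "?T 1 = a + b"
    using S_pair_recurrence(1,2)[OF ab] by simp_all
  from product_fps[of ?T _ _ ?U, OF T this U] show ?thesis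
    unfolding D R1 R2 unfolding R0 by (simp flip: fps_const_neg)
qed

theorem theorem5:
  fixes A E :: "coeff_ring set"
  defines "A \<equiv> {a\<^sub>1, a\<^sub>2}" and "E \<equiv> {e\<^sub>1, e\<^sub>2}"
  shows "Abs_fps (\<lambda>n. S (int n) A * S (2 * int n + 3) E) =
    fps_quot
      (fps_const ((e\<^sub>1 + e\<^sub>2) * ((e\<^sub>1 + e\<^sub>2)^2 - 2 * e\<^sub>1 * e\<^sub>2))
        - fps_const (e\<^sub>1^2 * e\<^sub>2^2 * (a\<^sub>1 + a\<^sub>2) * (e\<^sub>1 + e\<^sub>2)) * fps_X)
      (Abs_fps (\<lambda>n. S_neg (int n) A * e\<^sub>1^(2 * n)) *
       Abs_fps (\<lambda>n. S_neg (int n) A * e\<^sub>2^(2 * n)))"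
proof -
  have A: "(a\<^sub>1 :: coeff_ring) \<noteq> a\<^sub>2" and E: "(e\<^sub>1 :: coeff_ring) \<noteq> e\<^sub>2"
    by simp_all
  \<comment> \<open>Constant term 1 turns the quotient into the product identity already
    proved.\<close>
  have "fps_nth (Abs_fps (\<lambda>n. S_neg (int n) A * e\<^sub>1^(2 * n)) *
      Abs_fps (\<lambda>n. S_neg (int n) A * e\<^sub>2^(2 * n))) 0 = 1"
    unfolding A_def S_neg_pair_fps[OF A] by simp
  from fps_quot_eq_iff[OF this, THEN iffD2, symmetric] show ?thesis
    using S_pair_product_fps[OF A E, folded A_def E_def, symmetric] .
qed

end
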